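(* Let $\{P_n(x)\}_{n\ge 1}$ and $c_n(k)$ be as defined in the context. For every integer $k\ge 1$ there is a polynomial $R_k$ of degree $k-1$ with integer coefficients such that for every integer $n\ge1$, $$P_n(k)=c_n(k)\left(2^{n+k-1}-\frac{R_k(n)}{(2k-2)!!}\right).$$
   Context: The sequence $\{P_n(x)\}_{n\ge1}$ of rational functions of $x$ is defined by $P_1=P_2=1$ and, for $n\ge 2$: if $n$ is odd, $4(2x+n)P_{n+1}(x)=2(x+n)P_n(x)+(2x+n)P_n(x+1)+(4x+n)\ell_n(x)$; if $n$ is even, $4P_{n+1}(x)=4(x+n)P_n(x)+2(2x+n+1)P_n(x+1)+(4x+n)\ell_{n-1}(x)$. Here for odd $r\ge1$, $\ell_r(x)=\prod_{j=1}^{(r-1)/2}(x+j)$ (the empty product equals $1$). For integers $n,k\ge1$, $c_n(k)=(\frac{n-1}{2})!\prod_{i=1}^{k-1}\frac{n+i}{n+2i}$ if $n$ is odd and $c_n(k)=\frac12(\frac n2-1)!\prod_{i=0}^{k-1}\frac{n+i}{n+2i+1}$ if $n$ is even. Also $(2k-2)!!=2^{k-1}(k-1)!$. *)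

theory Defs
  imports "HOL-Computational_Algebra.Computational_Algebra" "HOL-Computational_Algebra.Field_as_Ring"
begin

text \<open>Rational functions of \<open>x\<close> are elements of \<^typ>\<open>rat poly fract\<close>.\<close>

definition rf_X :: "rat poly fract" where
  "rf_X = to_fract [:0, 1:]"

text \<open>
  Evaluation and the substitution \<open>x \<mapsto> x + 1\<close> use the reduced representation
  \<^const>\<open>quot_of_fract\<close>, so the value \<^term>\<open>rf_eval f x\<close> is meaningful exactly when \<open>x\<close> is
  not a pole of \<open>f\<close>. At a pole it is \<open>0\<close> by the convention for division.
\<close>

definition rf_eval :: "rat poly fract \<Rightarrow> rat \<Rightarrow> rat" where
  "rf_eval f x = poly (fst (quot_of_fract f)) x / poly (snd (quot_of_fract f)) x"

definition rf_regular :: "rat poly fract \<Rightarrow> rat \<Rightarrow> bool" where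
  "rf_regular f x \<longleftrightarrow> poly (snd (quot_of_fract f)) x \<noteq> 0"

definition rf_shift :: "rat poly fract \<Rightarrow> rat poly fract" where
  "rf_shift f = to_fract (pcompose (fst (quot_of_fract f)) [:1, 1:]) /
                to_fract (pcompose (snd (quot_of_fract f)) [:1, 1:])"

definition ell :: "nat \<Rightarrow> rat poly fract" where
  "ell r = (\<Prod>j = 1..(r - 1) div 2. rf_X + of_nat j)"

text \<open>The sequence starts at index 1; the value at index 0 is a dummy.\<close>

primrec P :: "nat \<Rightarrow> rat poly fract" where
  "P 0 = 0"
| "P (Suc n) =
     (if n < 2 then 1
      else if odd n then
        (2 * (rf_X + of_nat n) * P n + (2 * rf_X + of_nat n) * rf_shift (P n)
          + (4 * rf_X + of_nat n) * ell n) / (4 * (2 * rf_X + of_nat n))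
      else
        (4 * (rf_X + of_nat n) * P n + 2 * (2 * rf_X + of_nat n + 1) * rf_shift (P n)
          + (4 * rf_X + of_nat n) * ell (n - 1)) / 4)"

definition c :: "nat \<Rightarrow> nat \<Rightarrow> rat" where
  "c n k =
     (if odd n then
        fact ((n - 1) div 2) * (\<Prod>i = 1..k - 1. of_nat (n + i) / of_nat (n + 2 * i))
      else
        1 / 2 * fact (n div 2 - 1) * (\<Prod>i = 0..k - 1. of_nat (n + i) / of_nat (n + 2 * i + 1)))"

fun double_fact :: "nat \<Rightarrow> nat" where
  "double_fact 0 = 1"
| "double_fact (Suc 0) = 1"
| "double_fact (Suc (Suc n)) = Suc (Suc n) * double_fact n"

text \<open>
  The remaining lemmas confirm that the definitions have the intended meaning. In particular no
  \<^term>\<open>P n\<close> has a pole at a positive rational, so the junk value of \<^const>\<open>rf_eval\<close> plays no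
  role there.
\<close>

lemma double_fact_even: "double_fact (2 * m) = 2 ^ m * fact m"
  by (induction m) (simp_all add: algebra_simps)

lemma of_nat_fract: "(of_nat n :: rat poly fract) = to_fract (of_nat n)"
  by (induction n) simp_all

lemma linear_eq_to_fract: "2 * rf_X + of_nat n = to_fract [:of_nat n, 2:]"
proof -
  have "to_fract [:of_nat n, 2:] = to_fract ([:0, 1:] + [:0, 1:] + (of_nat n :: rat poly))"
    by (simp add: of_nat_poly)
  thus ?thesis
    unfolding to_fract_add rf_X_def of_nat_fract by simp
qed

lemma P_1: "P 1 = 1" and P_2: "P 2 = 1"
  by (simp_all add: numeral_2_eq_2)

lemma P_rec_odd:
  assumes "n \<ge> 2" "odd n"
  shows "4 * (2 * rf_X + of_nat n) * P (n + 1) =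
           2 * (rf_X + of_nat n) * P n + (2 * rf_X + of_nat n) * rf_shift (P n)
             + (4 * rf_X + of_nat n) * ell n"
proof -
  have "4 * (2 * rf_X + of_nat n) \<noteq> 0"
    by (simp add: linear_eq_to_fract)
  thus ?thesis using assms by simp
qed

lemma P_rec_even:
  assumes "n \<ge> 2" "even n"
  shows "4 * P (n + 1) =
           4 * (rf_X + of_nat n) * P n + 2 * (2 * rf_X + of_nat n + 1) * rf_shift (P n)
             + (4 * rf_X + of_nat n) * ell (n - 1)"
  using assms by simp

lemma rf_Fract:
  assumes "poly b x \<noteq> 0"
  shows rf_regular_Fract: "rf_regular (Fract a b) x"
    and rf_eval_Fract: "rf_eval (Fract a b) x = poly a x / poly b x"
proof -
  define p q where "p = fst (quot_of_fract (Fract a b))" and "q = snd (quot_of_fract (Fract a b))"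
  have "b \<noteq> 0" "q \<noteq> 0"
    using assms by (auto simp: q_def)
  moreover have "Fract p q = Fract a b"
    by (simp add: p_def q_def)
  ultimately have pq: "p * b = a * q"
    by (simp add: eq_fract)
  have "coprime p q"
    by (simp add: p_def q_def coprime_quot_of_fract)
  moreover have "q dvd p * b"
    using pq by simp
  ultimately have "q dvd b"
    by (simp add: coprime_commute coprime_dvd_mult_right_iff)
  hence "poly q x \<noteq> 0"
    using assms by (auto elim!: dvdE)
  thus "rf_regular (Fract a b) x"
    by (simp add: rf_regular_def q_def)
  have "poly p x * poly b x = poly a x * poly q x"
    using pq by (metis poly_mult)
  thus "rf_eval (Fract a b) x = poly a x / poly b x"
    using \<open>poly q x \<noteq> 0\<close> assms by (simp add: rf_eval_def p_def q_def field_simps)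
qed

lemma rf_regularE:
  assumes "rf_regular f x"
  obtains a b where "f = Fract a b" "poly b x \<noteq> 0"
  using assms that[of "fst (quot_of_fract f)" "snd (quot_of_fract f)"]
  by (simp add: rf_regular_def)

lemma rf_to_fract:
  shows rf_regular_to_fract: "rf_regular (to_fract p) x"
    and rf_eval_to_fract: "rf_eval (to_fract p) x = poly p x"
  by (simp_all add: to_fract_def rf_regular_Fract rf_eval_Fract)

lemma rf_add:
  assumes "rf_regular f x" "rf_regular g x"
  shows rf_regular_add: "rf_regular (f + g) x"
    and rf_eval_add: "rf_eval (f + g) x = rf_eval f x + rf_eval g x"
proof -
  obtain a b d e where f: "f = Fract a b" "poly b x \<noteq> 0" and g: "g = Fract d e" "poly e x \<noteq> 0"
    using assms by (metis rf_regularE)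
  hence "b \<noteq> 0" "e \<noteq> 0" by auto
  hence "f + g = Fract (a * e + d * b) (b * e)" using f g by simp
  thus "rf_regular (f + g) x" "rf_eval (f + g) x = rf_eval f x + rf_eval g x"
    using f g by (simp_all add: rf_regular_Fract rf_eval_Fract add_frac_eq)
qed

lemma rf_mult:
  assumes "rf_regular f x" "rf_regular g x"
  shows rf_regular_mult: "rf_regular (f * g) x"
    and rf_eval_mult: "rf_eval (f * g) x = rf_eval f x * rf_eval g x"
proof -
  obtain a b d e where f: "f = Fract a b" "poly b x \<noteq> 0" and g: "g = Fract d e" "poly e x \<noteq> 0"
    using assms by (metis rf_regularE)
  hence "f * g = Fract (a * d) (b * e)" by simp
  thus "rf_regular (f * g) x" "rf_eval (f * g) x = rf_eval f x * rf_eval g x"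
    using f g by (simp_all add: rf_regular_Fract rf_eval_Fract)
qed

lemma rf_divide:
  assumes "rf_regular f x" "rf_regular g x" "rf_eval g x \<noteq> 0"
  shows rf_regular_divide: "rf_regular (f / g) x"
    and rf_eval_divide: "rf_eval (f / g) x = rf_eval f x / rf_eval g x"
proof -
  obtain a b d e where f: "f = Fract a b" "poly b x \<noteq> 0" and g: "g = Fract d e" "poly e x \<noteq> 0"
    using assms by (metis rf_regularE)
  hence d: "poly d x \<noteq> 0" using assms(3) by (auto simp: rf_eval_Fract)
  have "f / g = Fract (a * e) (b * d)" using f g by simp
  thus "rf_regular (f / g) x" "rf_eval (f / g) x = rf_eval f x / rf_eval g x"
    using f g d by (simp_all add: rf_regular_Fract rf_eval_Fract)
qed

lemma rf_shift:
  assumes "rf_regular f (x + 1)"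
  shows rf_regular_shift: "rf_regular (rf_shift f) x"
    and rf_eval_shift: "rf_eval (rf_shift f) x = rf_eval f (x + 1)"
proof -
  have "rf_shift f = Fract (pcompose (fst (quot_of_fract f)) [:1, 1:])
                           (pcompose (snd (quot_of_fract f)) [:1, 1:])"
    by (simp add: rf_shift_def to_fract_def)
  moreover have "poly (pcompose (snd (quot_of_fract f)) [:1, 1:]) x \<noteq> 0"
    using assms by (simp add: rf_regular_def poly_pcompose add.commute)
  ultimately show "rf_regular (rf_shift f) x" "rf_eval (rf_shift f) x = rf_eval f (x + 1)"
    by (simp_all add: rf_regular_Fract rf_eval_Fract rf_eval_def[of f] poly_pcompose add.commute)
qed

lemma rf_of_nat: "rf_regular (of_nat n) x" "rf_eval (of_nat n) x = of_nat n"
  by (simp_all add: of_nat_fract rf_to_fract of_nat_poly)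

lemma rf_numeral: "rf_regular (numeral m) x" "rf_eval (numeral m) x = numeral m"
  using rf_of_nat[of "numeral m" x] by simp_all

lemma rf_one: "rf_regular 1 x" "rf_eval 1 x = 1"
  using rf_of_nat[of 1 x] by simp_all

lemma rf_X: "rf_regular rf_X x" "rf_eval rf_X x = x"
  by (simp_all add: rf_X_def rf_to_fract)

lemmas rf_simps =
  rf_add rf_mult rf_of_nat rf_numeral rf_one rf_X

lemma rf_ell:
  "rf_regular (ell r) x" "rf_eval (ell r) x = (\<Prod>j = 1..(r - 1) div 2. x + of_nat j)"
proof -
  have "rf_regular (\<Prod>j\<in>A. rf_X + of_nat j) x \<and>
        rf_eval (\<Prod>j\<in>A. rf_X + of_nat j) x = (\<Prod>j\<in>A. x + of_nat j)" if "finite A" for A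
    using that by induction (simp_all add: rf_simps)
  thus "rf_regular (ell r) x" "rf_eval (ell r) x = (\<Prod>j = 1..(r - 1) div 2. x + of_nat j)"
    by (simp_all add: ell_def)
qed

lemma rf_regular_P:
  assumes "n \<ge> 1" "x > 0"
  shows "rf_regular (P n) x"
  using assms
proof (induction n arbitrary: x rule: dec_induct)
  case base
  thus ?case by (simp add: rf_simps)
next
  case (step n)
  have "rf_regular (P n) x" "rf_regular (rf_shift (P n)) x"
    using step by (simp_all add: rf_regular_shift)
  moreover have "2 * x + of_nat n \<noteq> 0"
    using step.prems by (metis add_pos_nonneg less_irrefl mult_pos_pos of_nat_0_le_iff zero_less_numeral)
  ultimately show ?case
    by (auto simp: rf_simps rf_ell intro!: rf_regular_divide)
qed

end

theory Submission
  imports Defs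
begin

text \<open>
  The polynomials are explicit: \<open>R\<^sub>k(n) = (k - 1)! \<Sum>\<^bsub>j<k\<^esub> binom(n + 2k - 1, j)\<close>. Dividing the
  recurrences by \<open>c\<^sub>n(k)\<close> turns both of them into the single recurrence
  \<open>2 T\<^sub>n\<^sub>+\<^sub>1(k) = 2 T\<^sub>n(k) + T\<^sub>n(k + 1) + 2\<^sup>-\<^sup>k (binom(N, k) + 3 binom(N, k - 1))\<close> with \<open>N = n + 2k - 1\<close>,
  and Pascal's rule shows that \<open>T\<^sub>n(k) = 2\<^sup>n\<^sup>+\<^sup>k\<^sup>-\<^sup>1 - 2\<^sup>1\<^sup>-\<^sup>k \<Sum>\<^bsub>j<k\<^esub> binom(N, j)\<close> solves it.
  The closed form comes from the generating function
  \<open>\<Sum>\<^sub>m w\<^sup>m \<Sum>\<^bsub>j\<le>m\<^esub> binom(n + 2m + 1, j) = B(w)\<^sup>n / (1 - 4w)\<close>, \<open>B\<close> being that of the Catalan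
  numbers.
\<close>

section \<open>Partial row sums of Pascal's triangle and the normalized recurrence\<close>

definition binomial_sum :: "nat \<Rightarrow> nat \<Rightarrow> rat" where
  "binomial_sum N m = (\<Sum>j\<le>m. of_nat (N choose j))"

text \<open>By Pascal's rule each entry of row \<open>N\<close> up to index \<open>m\<close> feeds
  two entries of row \<open>Suc N\<close>. Both lie in the range, except that the second one fed by
  \<open>N choose m\<close> has index m + 1.\<close>

lemma binomial_sum_Suc_left:
  "binomial_sum (Suc N) m = 2 * binomial_sum N m - of_nat (N choose m)"
  by (induction m) (simp_all add: binomial_sum_def)

lemma binomial_sum_Suc_right:
  "binomial_sum N (Suc m) = binomial_sum N m + of_nat (N choose Suc m)"
  by (simp add: binomial_sum_def)

text \<open>Row 2m + 2 is symmetric about its middle entry, so twice the sum below the middle is the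
  full row sum less that entry. This is the row sum occurring in \<open>ratio 1 m\<close>.\<close>

lemma binomial_sum_half:
  "2 * binomial_sum (2 * m + 2) m = 4 ^ Suc m - of_nat ((2 * m + 2) choose Suc m)"
proof (induction m)
  case 0
  show ?case by (simp add: binomial_sum_def)
next
  case (Suc m)
  define N where "N = 2 * m + 2"
  have "N choose Suc (Suc m) = N choose m"
    using binomial_symmetric[of m N] by (simp add: N_def)
  moreover have "2 * Suc m + 2 = Suc (Suc N)"
    by (simp add: N_def)
  ultimately show ?case
    using Suc[folded N_def] by (simp add: binomial_sum_Suc_left binomial_sum_Suc_right)
qed

text \<open>The quotient \<open>P\<^sub>n(k) / c\<^sub>n(k)\<close> for \<open>k = m + 1\<close>.\<close>

definition ratio :: "nat \<Rightarrow> nat \<Rightarrow> rat" where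
  "ratio n m = 2 ^ (n + m) - binomial_sum (2 * m + n + 1) m / 2 ^ m"

lemma binomial_absorb_rat:
  "of_nat (Suc j) * (of_nat ((N + Suc j) choose Suc j) :: rat)
     = of_nat (Suc N) * of_nat ((N + Suc j) choose j)"
proof -
  have "Suc j * ((N + Suc j) choose Suc j) = Suc N * ((N + Suc j) choose j)"
    using Suc_times_binomial_add[of j N] by (simp add: ac_simps)
  thus ?thesis by (metis of_nat_mult)
qed

text \<open>With N = 2m + n + 1 and k = m + 1, Pascal's rule leaves the inhomogeneous term binom(N,
  k) + 3 binom(N, k - 1) over 2^k. Multiplication by n + k and the absorption (n + k) binom(N, k -
  1) = k binom(N, k) merge it into (4k + n) binom(N, k), which shows the factor 4x + n that stands
  before \<open>ell\<close> in both recurrences for \<open>P\<close>.\<close>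

lemma ratio_Suc:
  "of_nat (n + Suc m) * (2 * ratio (Suc n) m) = 
     of_nat (n + Suc m) * (2 * ratio n m + ratio n (Suc m)) +
     of_nat (4 * Suc m + n) * of_nat ((2 * m + n + 1) choose Suc m) / 2 ^ Suc m"
proof -
  let ?N = "2 * m + n + 1"
  let ?g = "of_nat (?N choose Suc m) + 3 * of_nat (?N choose m) :: rat"
  have "2 * ratio (Suc n) m = 2 * ratio n m + ratio n (Suc m) + ?g / 2 ^ Suc m"
    by (simp add: ratio_def binomial_sum_Suc_left binomial_sum_Suc_right field_simps)
  moreover have "of_nat (n + Suc m) * ?g
      = (of_nat (4 * Suc m + n) * of_nat (?N choose Suc m) :: rat)"
  proof -
    have N: "n + m + Suc m = ?N" by simp
    have "of_nat (Suc m) * (of_nat (?N choose Suc m) :: rat)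
        = of_nat (Suc (n + m)) * of_nat (?N choose m)"
      using binomial_absorb_rat[of m "n + m"] unfolding N .
    thus ?thesis
      by (simp add: ring_distribs del: binomial_Suc_Suc)
  qed
  ultimately show ?thesis
    by (simp add: ring_distribs)
qed

section \<open>Recurrences of c_n(k) in both indices\<close>

lemma c_Suc_odd:
  "odd n \<Longrightarrow> of_nat (n + 2 * Suc m) * c n (Suc (Suc m)) = of_nat (n + Suc m) * c n (Suc m)"
  by (simp add: c_def field_simps)

lemma c_Suc_even:
  "even n \<Longrightarrow>
     of_nat (n + 2 * Suc m + 1) * c n (Suc (Suc m)) = of_nat (n + Suc m) * c n (Suc m)"
  by (simp add: c_def field_simps)


text \<open>The laws in k for \<open>n\<close> and for \<open>Suc n\<close> carry the relation from
  one k to the next. It turns the coefficient 4(2k + n) c_{n+1}(k) of the odd recurrence into 2(n +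
  k) c_n(k), so that c_n(k) can be divided out.\<close>

lemma c_Suc_left_odd:
  assumes "odd n"
  shows "2 * of_nat (n + 2 * Suc m) * c (Suc n) (Suc m) = of_nat (n + Suc m) * c n (Suc m)"
proof (induction m)
  case 0
  obtain r where "n = 2 * r + 1" using assms by (rule oddE)
  thus ?case by (simp add: c_def field_simps)
next
  case (Suc m)
  define a x :: rat where "a = of_nat n" and "x = of_nat (Suc m)"
  have "even (Suc n)" using assms by simp
  hence "(a + 2 * x + 2) * c (Suc n) (Suc (Suc m)) = (a + x + 1) * c (Suc n) (Suc m)"
    using c_Suc_even[of "Suc n" m] by (simp add: a_def x_def add_ac)
  moreover have "(a + 2 * x) * c n (Suc (Suc m)) = (a + x) * c n (Suc m)"
    using c_Suc_odd[OF assms, of m] by (simp add: a_def x_def add_ac)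
  moreover have "2 * (a + 2 * x) * c (Suc n) (Suc m) = (a + x) * c n (Suc m)"
    using Suc.IH by (simp add: a_def x_def add_ac)
  ultimately have "(a + 2 * x) * (2 * (a + 2 * x + 2) * c (Suc n) (Suc (Suc m)))
      = (a + 2 * x) * ((a + x + 1) * c n (Suc (Suc m)))"
    by algebra
  moreover have "a + 2 * x \<noteq> 0"
    unfolding a_def x_def by (simp add: add_nonneg_eq_0_iff)
  ultimately have "2 * (a + 2 * x + 2) * c (Suc n) (Suc (Suc m)) = (a + x + 1) * c n (Suc (Suc m))"
    by (metis mult_left_cancel)
  thus ?case by (simp add: a_def x_def add_ac)
qed

lemma c_Suc_left_even:
  assumes "even n" "n \<ge> 2"
  shows "c (Suc n) (Suc m) = of_nat (n + Suc m) * c n (Suc m)"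
proof (induction m)
  case 0
  obtain r where "n = 2 * Suc r"
    using assms by (metis dvdE mult_is_0 not0_implies_Suc not_numeral_le_zero)
  thus ?case by (simp add: c_def field_simps)
next
  case (Suc m)
  define a x :: rat where "a = of_nat n" and "x = of_nat (Suc m)"
  have "odd (Suc n)" using assms by simp
  hence "(a + 2 * x + 1) * c (Suc n) (Suc (Suc m)) = (a + x + 1) * c (Suc n) (Suc m)"
    using c_Suc_odd[of "Suc n" m] by (simp add: a_def x_def add_ac)
  moreover have "(a + 2 * x + 1) * c n (Suc (Suc m)) = (a + x) * c n (Suc m)"
    using c_Suc_even[OF assms(1), of m] by (simp add: a_def x_def add_ac)
  moreover have "c (Suc n) (Suc m) = (a + x) * c n (Suc m)"
    using Suc.IH by (simp add: a_def x_def add_ac)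
  ultimately have "(a + 2 * x + 1) * c (Suc n) (Suc (Suc m))
      = (a + 2 * x + 1) * ((a + x + 1) * c n (Suc (Suc m)))"
    by algebra
  moreover have "a + 2 * x + 1 \<noteq> 0"
    unfolding a_def x_def by (simp add: add_nonneg_eq_0_iff)
  ultimately have "c (Suc n) (Suc (Suc m)) = (a + x + 1) * c n (Suc (Suc m))"
    by (metis mult_left_cancel)
  thus ?case by (simp add: a_def x_def add_ac)
qed

section \<open>Values of the products \<open>ell\<close> as multiples of c_n(k)\<close>

lemma prod_add_shift:
  fixes x :: "'a :: comm_ring_1"
  shows "(x + 1) * (\<Prod>j = 1..r. x + 1 + of_nat j) = (x + 1 + of_nat r) * (\<Prod>j = 1..r. x + of_nat j)"
proof (induction r)
  case (Suc r)
  have "(x + 1) * (\<Prod>j = 1..Suc r. x + 1 + of_nat j)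
      = ((x + 1) * (\<Prod>j = 1..r. x + 1 + of_nat j)) * (x + 1 + of_nat (Suc r))"
    by (simp add: mult.assoc)
  also note Suc.IH
  finally show ?case by (simp add: algebra_simps)
qed simp

text \<open>As k grows by one, the upper index grows by two and the lower by one. One absorption
  raises both indices, another raises the upper index alone.\<close>

lemma binomial_central_step:
  "of_nat (Suc (Suc m)) * of_nat (n + Suc m) * (of_nat ((2 * Suc m + n + 1) choose Suc (Suc m)) :: rat)
     = of_nat (n + 2 * Suc m + 1) * of_nat (n + 2 * Suc m) * of_nat ((2 * m + n + 1) choose Suc m)"
proof -
  define N where "N = 2 * m + n + 1"
  have "Suc (Suc m) * (Suc (Suc N) choose Suc (Suc m)) = Suc (Suc N) * (Suc N choose Suc m)"
    by (rule Suc_times_binomial)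
  moreover have "(n + Suc m) * (Suc N choose Suc m) = Suc N * (N choose Suc m)"
    using binomial_absorb_comp[of "Suc N" "Suc m"] by (simp add: N_def add_ac del: binomial_Suc_Suc)
  ultimately have "Suc (Suc m) * (n + Suc m) * (Suc (Suc N) choose Suc (Suc m))
      = Suc (Suc N) * Suc N * (N choose Suc m)"
    by (metis mult.assoc mult.left_commute)
  moreover have "Suc (Suc N) = 2 * Suc m + n + 1" "Suc N = n + 2 * Suc m"
    "Suc (Suc N) = n + 2 * Suc m + 1"
    by (simp_all add: N_def)
  ultimately show ?thesis
    by (metis N_def of_nat_mult)
qed

text \<open>For n = 2r + 1 the product is ell_n(k) at k = m + 1. Dividing the inhomogeneous term of
  the odd recurrence by c_n(k) thus yields exactly the binomial term of
  \<open>ratio_Suc\<close>.\<close>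

lemma prod_eq_c_odd:
  "2 ^ Suc m * (\<Prod>j = 1..r. of_nat (Suc m) + of_nat j)
     = c (2 * r + 1) (Suc m) * of_nat ((2 * m + (2 * r + 1) + 1) choose Suc m)"
proof (induction m)
  case 0
  have "(\<Prod>j = 1..r. 1 + of_nat j) = (fact (Suc r) :: rat)"
    by (induction r) (simp_all add: algebra_simps)
  thus ?case by (simp add: c_def algebra_simps)
next
  case (Suc m)
  define n where "n = 2 * r + 1"
  define x :: rat where "x = of_nat (Suc m)"
  define Q where "Q y = (\<Prod>j = 1..r. y + of_nat j)" for y :: rat
  define C C' :: rat where "C = of_nat ((2 * m + n + 1) choose Suc m)"
    and "C' = of_nat ((2 * Suc m + n + 1) choose Suc (Suc m))"
  define d d' where "d = c n (Suc m)" and "d' = c n (Suc (Suc m))"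
  have IH: "2 ^ Suc m * Q x = d * C"
    using Suc by (simp only: n_def x_def Q_def C_def d_def)
  have Q: "(x + 1) * Q (x + 1) = (x + 1 + of_nat r) * Q x"
    unfolding Q_def by (rule prod_add_shift)
  have n: "of_nat n = 2 * of_nat r + (1 :: rat)"
    by (simp add: n_def)
  have C: "(x + 1) * (of_nat n + x) * C' = (of_nat n + 2 * x + 1) * (of_nat n + 2 * x) * C"
    using binomial_central_step[of m n] by (simp add: C_def C'_def x_def algebra_simps del: binomial_Suc_Suc)
  have "odd n" by (simp add: n_def)
  from c_Suc_odd[OF this, of m] have d: "(of_nat n + 2 * x) * d' = (of_nat n + x) * d"
    by (simp add: d_def d'_def x_def algebra_simps)
  have pos: "x > 0" "of_nat n > (0 :: rat)"
    by (simp_all add: x_def n_def)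
  \<comment> \<open>The prefactor collects the denominators of the step laws for \<open>Q\<close>,
    \<open>C'\<close> and \<open>d'\<close>; it is positive and cancels at the end.\<close>
  have "(x + 1) * (of_nat n + x) * (of_nat n + 2 * x) * (2 ^ Suc (Suc m) * Q (x + 1))
      = (of_nat n + x) * (of_nat n + 2 * x) * 2 * 2 ^ Suc m * ((x + 1) * Q (x + 1))"
    by (simp only: power_Suc ac_simps)
  also have "\<dots> = (of_nat n + x) * (of_nat n + 2 * x) * (2 * (x + 1 + of_nat r)) * (2 ^ Suc m * Q x)"
    unfolding Q by (simp only: ac_simps)
  \<comment> \<open>Here n = 2r + 1 gives 2(x + 1 + r) = n + 2x + 1.\<close>
  also have "\<dots> = ((of_nat n + 2 * x + 1) * (of_nat n + 2 * x) * C) * ((of_nat n + x) * d)"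
    unfolding IH by (simp add: n algebra_simps)
  also have "\<dots> = (x + 1) * (of_nat n + x) * (of_nat n + 2 * x) * (d' * C')"
    unfolding C[symmetric] d[symmetric] by (simp only: ac_simps)
  finally have "2 ^ Suc (Suc m) * Q (x + 1) = d' * C'"
    using pos by (auto simp: add_eq_0_iff)
  moreover have "x + 1 = of_nat (Suc (Suc m))" by (simp add: x_def)
  ultimately show ?case
    by (simp only: n_def Q_def C'_def d'_def)
qed

text \<open>For n = 2r + 2 the product is ell_{n-1}(k). The power of two is one lower than in the
  odd case because of the factor 1/2 in \<open>c\<close>; in the induction step 2(x + 1 + r) is now
  n + 2x.\<close>

lemma prod_eq_c_even:
  "2 ^ m * (\<Prod>j = 1..r. of_nat (Suc m) + of_nat j)
     = c (2 * r + 2) (Suc m) * of_nat ((2 * m + (2 * r + 2) + 1) choose Suc m)"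
proof (induction m)
  case 0
  have "(\<Prod>j = 1..r. 1 + of_nat j) = (fact (Suc r) :: rat)"
    by (induction r) (simp_all add: algebra_simps)
  thus ?case by (simp add: c_def field_simps)
next
  case (Suc m)
  define n where "n = 2 * r + 2"
  define x :: rat where "x = of_nat (Suc m)"
  define Q where "Q y = (\<Prod>j = 1..r. y + of_nat j)" for y :: rat
  define C C' :: rat where "C = of_nat ((2 * m + n + 1) choose Suc m)"
    and "C' = of_nat ((2 * Suc m + n + 1) choose Suc (Suc m))"
  define d d' where "d = c n (Suc m)" and "d' = c n (Suc (Suc m))"
  have IH: "2 ^ m * Q x = d * C"
    using Suc by (simp only: n_def x_def Q_def C_def d_def)
  have Q: "(x + 1) * Q (x + 1) = (x + 1 + of_nat r) * Q x"
    unfolding Q_def by (rule prod_add_shift)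
  have n: "of_nat n = 2 * of_nat r + (2 :: rat)"
    by (simp add: n_def)
  have C: "(x + 1) * (of_nat n + x) * C' = (of_nat n + 2 * x + 1) * (of_nat n + 2 * x) * C"
    using binomial_central_step[of m n] by (simp add: C_def C'_def x_def algebra_simps del: binomial_Suc_Suc)
  have "even n" by (simp add: n_def)
  from c_Suc_even[OF this, of m] have d: "(of_nat n + 2 * x + 1) * d' = (of_nat n + x) * d"
    by (simp add: d_def d'_def x_def algebra_simps)
  have pos: "x > 0" "of_nat n > (0 :: rat)"
    by (simp_all add: x_def n_def)
  have "(x + 1) * (of_nat n + x) * (of_nat n + 2 * x + 1) * (2 ^ Suc m * Q (x + 1))
      = (of_nat n + x) * (of_nat n + 2 * x + 1) * 2 * 2 ^ m * ((x + 1) * Q (x + 1))"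
    by (simp only: power_Suc ac_simps)
  also have "\<dots> = (of_nat n + x) * (of_nat n + 2 * x + 1) * (2 * (x + 1 + of_nat r)) * (2 ^ m * Q x)"
    unfolding Q by (simp only: ac_simps)
  also have "\<dots> = ((of_nat n + 2 * x + 1) * (of_nat n + 2 * x) * C) * ((of_nat n + x) * d)"
    unfolding IH by (simp add: n algebra_simps)
  also have "\<dots> = (x + 1) * (of_nat n + x) * (of_nat n + 2 * x + 1) * (d' * C')"
    unfolding C[symmetric] d[symmetric] by (simp only: ac_simps)
  finally have "2 ^ Suc m * Q (x + 1) = d' * C'"
    using pos by (auto simp: add_eq_0_iff)
  moreover have "x + 1 = of_nat (Suc (Suc m))" by (simp add: x_def)
  ultimately show ?case
    by (simp only: n_def Q_def C'_def d'_def)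
qed

section \<open>The recurrences evaluated at positive points, and the values P_n(k)\<close>

lemma rf_eval_P_odd:
  assumes "odd n" "x > 0"
  shows "4 * (2 * x + of_nat n) * rf_eval (P (Suc n)) x =
           2 * (x + of_nat n) * rf_eval (P n) x + (2 * x + of_nat n) * rf_eval (P n) (x + 1)
             + (4 * x + of_nat n) * (\<Prod>j = 1..(n - 1) div 2. x + of_nat j)"
proof (cases "n = 1")
  \<comment> \<open>\<open>P_rec_odd\<close> starts at 2, but P_1 = P_2 = 1 satisfy the same
    relation because 2(x + 1) + (2x + 1) + (4x + 1) = 4(2x + 1). The induction for
    \<open>rf_eval_P\<close> can therefore start at n = 1.\<close>
  case True
  thus ?thesis by (simp add: rf_simps)
next
  case False
  hence n: "n \<ge> 2" "n \<ge> 1" using assms by presburger+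
  have "rf_regular (P n) x" "rf_regular (P n) (x + 1)" "rf_regular (P (n + 1)) x"
    using n assms by (intro rf_regular_P; simp)+
  thus ?thesis
    using arg_cong[OF P_rec_odd[OF n(1) assms(1)], of "\<lambda>f. rf_eval f x"]
    by (simp add: rf_simps rf_ell rf_shift del: P.simps)
qed

lemma rf_eval_P_even:
  assumes "even n" "n \<ge> 2" "x > 0"
  shows "4 * rf_eval (P (Suc n)) x =
           4 * (x + of_nat n) * rf_eval (P n) x + 2 * (2 * x + of_nat n + 1) * rf_eval (P n) (x + 1)
             + (4 * x + of_nat n) * (\<Prod>j = 1..(n - 2) div 2. x + of_nat j)"
proof -
  have "rf_regular (P n) x" "rf_regular (P n) (x + 1)" "rf_regular (P (n + 1)) x"
    using assms by (intro rf_regular_P; simp)+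
  thus ?thesis
    using arg_cong[OF P_rec_even[OF assms(2,1)], of "\<lambda>f. rf_eval f x"]
    by (simp add: rf_simps rf_ell rf_shift numeral_2_eq_2 del: P.simps)
qed

lemma ratio_1: "c 1 (Suc m) * ratio 1 m = 1"
proof -
  have r: "ratio 1 m = of_nat ((2 * m + 2) choose Suc m) / 2 ^ Suc m"
    using binomial_sum_half[of m] power_mult_distrib[of "2::rat" 2 m]
    by (simp add: ratio_def field_simps del: binomial_Suc_Suc)
  have "c 1 (Suc m) * of_nat ((2 * m + 2) choose Suc m) = 2 ^ Suc m"
    \<comment> \<open>With r = 0 the product is empty.\<close>
    using prod_eq_c_odd[of m 0] by (simp del: binomial_Suc_Suc)
  thus ?thesis unfolding r by (simp del: binomial_Suc_Suc)
qed

theorem rf_eval_P: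
  assumes "n \<ge> 1"
  shows "rf_eval (P n) (of_nat (Suc m)) = c n (Suc m) * ratio n m"
  using assms
\<comment> \<open>The shift in the recurrence needs the hypothesis at k + 1 as well, so
  \<open>m\<close> stays arbitrary.\<close>
proof (induction n arbitrary: m rule: dec_induct)
  case base
  show ?case using ratio_1[of m] by (simp add: rf_simps)
next
  case (step n)
  define a x :: rat where "a = of_nat n" and "x = of_nat (Suc m)"
  define d d' where "d = c n (Suc m)" and "d' = c n (Suc (Suc m))"
  define e where "e = c (Suc n) (Suc m)"
  define t t' u where "t = ratio n m" and "t' = ratio n (Suc m)" and "u = ratio (Suc n) m"
  define g p where "g = (of_nat ((2 * m + n + 1) choose Suc m) / 2 ^ Suc m :: rat)"
    and "p = rf_eval (P (Suc n)) x"
  have pos: "x > 0" "a > 0" using step.hyps by (simp_all add: x_def a_def)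
  have x1: "x + 1 = of_nat (Suc (Suc m))" by (simp add: x_def)
  have u: "(a + x) * (2 * u) = (a + x) * (2 * t + t') + (4 * x + a) * g"
    using ratio_Suc[of n m] by (simp add: a_def x_def u_def t_def t'_def g_def add_ac del: binomial_Suc_Suc)
  have IH: "rf_eval (P n) x = d * t" "rf_eval (P n) (x + 1) = d' * t'"
    unfolding x1 unfolding x_def d_def d'_def t_def t'_def by (rule step.IH)+
  have "p = e * u"
  proof (cases "odd n")
    case True
    then obtain r where r: "n = 2 * r + 1" by (rule oddE)
    have "(\<Prod>j = 1..(n - 1) div 2. x + of_nat j) = d * g"
      using prod_eq_c_odd[of m r] by (simp add: r x_def d_def g_def field_simps del: binomial_Suc_Suc)
    hence "4 * (2 * x + a) * p = 2 * (x + a) * (d * t) + (2 * x + a) * (d' * t') + (4 * x + a) * (d * g)"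
      using rf_eval_P_odd[OF True pos(1)] by (simp only: IH a_def p_def)
    moreover have "(a + 2 * x) * d' = (a + x) * d"
      using c_Suc_odd[OF True, of m] by (simp add: a_def x_def d_def d'_def add_ac)
    moreover have "2 * (a + 2 * x) * e = (a + x) * d"
      using c_Suc_left_odd[OF True, of m] by (simp add: a_def x_def d_def e_def add_ac)
    \<comment> \<open>Both sides are \<open>d\<close> times the corresponding sides of
      \<open>u\<close>; in the even case the common multiplier is \<open>2 * d\<close>.\<close>
    ultimately have "(4 * (2 * x + a)) * p = (4 * (2 * x + a)) * (e * u)"
      using u by algebra
    thus ?thesis using pos by (simp add: add_eq_0_iff)
  next
    case False
    hence n: "even n" "n \<ge> 2" using step.hyps by presburger+
    hence "\<exists>r. n = 2 * r + 2" by presburger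
    then obtain r where r: "n = 2 * r + 2" by blast
    have "(\<Prod>j = 1..(n - 2) div 2. x + of_nat j) = 2 * d * g"
      using prod_eq_c_even[of m r] by (simp add: r x_def d_def g_def field_simps del: binomial_Suc_Suc)
    hence "4 * p = 4 * (x + a) * (d * t) + 2 * (2 * x + a + 1) * (d' * t') + (4 * x + a) * (2 * d * g)"
      using rf_eval_P_even[OF n pos(1)] by (simp only: IH a_def p_def)
    moreover have "(a + 2 * x + 1) * d' = (a + x) * d"
      using c_Suc_even[OF n(1), of m] by (simp add: a_def x_def d_def d'_def add_ac)
    moreover have "e = (a + x) * d"
      using c_Suc_left_even[OF n, of m] by (simp add: a_def x_def d_def e_def add_ac)
    ultimately have "4 * p = 4 * (e * u)"
      using u by algebra
    thus ?thesis by simp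
  qed
  thus ?case by (simp only: p_def e_def u_def x_def)
qed

section \<open>The integer polynomials R_k\<close>

definition falling_poly :: "nat \<Rightarrow> nat \<Rightarrow> int poly" where
  "falling_poly N j = (\<Prod>i<j. [:int N - int i, 1:])"

lemma degree_falling_poly: "degree (falling_poly N j) = j"
  and lead_coeff_falling_poly: "lead_coeff (falling_poly N j) = 1"
proof -
  show "degree (falling_poly N j) = j"
    by (simp add: falling_poly_def degree_prod_eq_sum_degree)
  show "lead_coeff (falling_poly N j) = 1"
    unfolding falling_poly_def lead_coeff_prod by simp
qed

lemma poly_falling_poly: "rat_of_int (poly (falling_poly N j) (int n)) = fact j * of_nat ((N + n) choose j)"
proof -
  have "fact j * rat_of_nat ((N + n) choose j) = (\<Prod>i = 0..<j. of_nat (N + n) - of_nat i)"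
    by (simp add: binomial_gbinomial gbinomial_mult_fact)
  thus ?thesis
    by (simp add: falling_poly_def poly_prod lessThan_atLeast0 algebra_simps)
qed

text \<open>Here m = k - 1. Since j is at most m, the integer division is exact and clears the
  denominators of the binomial polynomials.\<close>

definition R_poly :: "nat \<Rightarrow> int poly" where
  "R_poly m = (\<Sum>j\<le>m. smult (fact m div fact j) (falling_poly (2 * m + 1) j))"

text \<open>Only the summand j = m reaches degree m; it is monic and its factor is m!/m! = 1. This
  makes the degree exact and the polynomial nonzero.\<close>

lemma coeff_R_poly: "coeff (R_poly m) m = 1"
proof -
  have "coeff (R_poly m) m = (\<Sum>j\<le>m. if j = m then 1 else 0)"
    unfolding R_poly_def coeff_sum
  proof (intro sum.cong refl)
    fix j assume "j \<in> {..m}"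
    thus "coeff (smult (fact m div fact j) (falling_poly (2 * m + 1) j)) m = (if j = m then 1 else 0)"
      using lead_coeff_falling_poly[of "2 * m + 1" m]
      by (auto simp: degree_falling_poly coeff_eq_0)
  qed
  thus ?thesis by simp
qed

lemma degree_R_poly: "degree (R_poly m) = m"
proof (rule antisym)
  show "degree (R_poly m) \<le> m"
    unfolding R_poly_def
    by (intro degree_sum_le order.trans[OF degree_smult_le]) (simp_all add: degree_falling_poly)
  show "m \<le> degree (R_poly m)"
    by (rule le_degree) (simp add: coeff_R_poly)
qed

lemma poly_R_poly: "rat_of_int (poly (R_poly m) (int n)) = fact m * binomial_sum (2 * m + n + 1) m"
proof -
  have "rat_of_int (poly (R_poly m) (int n))
      = (\<Sum>j\<le>m. of_int (fact m div fact j) * (fact j * of_nat ((2 * m + 1 + n) choose j)))"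
    by (simp add: R_poly_def poly_sum poly_falling_poly)
  also have "\<dots> = (\<Sum>j\<le>m. fact m * of_nat ((2 * m + n + 1) choose j))"
  proof (intro sum.cong refl)
    fix j assume "j \<in> {..m}"
    hence "(fact m div fact j) * fact j = (fact m :: int)"
      by (intro dvd_div_mult_self fact_dvd) simp
    hence "of_int (fact m div fact j) * fact j = (fact m :: rat)"
      by (metis of_int_fact of_int_mult)
    thus "of_int (fact m div fact j) * (fact j * of_nat ((2 * m + 1 + n) choose j))
        = (fact m * of_nat ((2 * m + n + 1) choose j) :: rat)"
      by (simp add: mult.assoc[symmetric] add_ac)
  qed
  finally show ?thesis by (simp add: binomial_sum_def sum_distrib_left)
qed

theorem theorem3:
  fixes k :: nat
  assumes "k \<ge> 1"
  shows "\<exists>R :: int poly. R \<noteq> 0 \<and> degree R = k - 1 \<and>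
           (\<forall>n::nat. n \<ge> 1 \<longrightarrow>
              rf_eval (P n) (of_nat k) =
                c n k * (2 ^ (n + k - 1) - of_int (poly R (int n)) / of_nat (double_fact (2 * k - 2))))"
proof -
  obtain m where k: "k = Suc m"
    using assms by (cases k) auto
  have "R_poly m \<noteq> 0"
    using coeff_R_poly[of m] by auto
  moreover have "rf_eval (P n) (of_nat k) =
      c n k * (2 ^ (n + k - 1) - of_int (poly (R_poly m) (int n)) / of_nat (double_fact (2 * k - 2)))"
    if "n \<ge> 1" for n
    \<comment> \<open>As (2m)!! = 2^m m!, the factor m! of \<open>poly_R_poly\<close> cancels and
      leaves the denominator 2^m of \<open>ratio\<close>.\<close>
    using rf_eval_P[OF that, of m] double_fact_even[of m]
    by (simp add: k ratio_def poly_R_poly)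
  ultimately show ?thesis
    using degree_R_poly[of m] k by (intro exI[of _ "R_poly m"]) simp
qed

end
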